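(* Let $R$ be a ring, $n\ge 1$, and $\theta\in \mathrm{Aut}(R)$. Let $\varphi:M_n(R)\to M_n(R)$ be the additive isomorphism defined by $\varphi(A)_{ij}=\theta^{i-1}(a_{ij})$ for $A=(a_{ij})\in M_n(R)$, and define a product on $M_n(R)$ by $A*B=\varphi(\varphi^{-1}(A)\varphi^{-1}(B))$, where the product inside $\varphi$ is the usual matrix product. Then for all $A=(a_{ij})$ and $B=(b_{ij})$ in $M_n(R)$ and all $1\le i,j\le n$, $$(A*B)_{ij}=\sum_{k=1}^n a_{ik}\,\theta^{i-k}(b_{kj}).$$
   Context: Rings are associative with a unit element, not necessarily commutative. $\mathrm{Aut}(R)$ denotes the group of ring automorphisms of $R$; negative powers of $\theta$ are powers of $\theta^{-1}$. *)

theory Defs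
  imports "Jordan_Normal_Form.Matrix"
begin

text \<open>
  A possibly trivial unital ring is a type of sort \<open>{ring, monoid_mult}\<close>; the class \<open>ring_1\<close>
  would additionally demand \<open>0 \<noteq> 1\<close>.
\<close>

definition ring_automorphisms :: "('a::{ring, monoid_mult} \<Rightarrow> 'a) set" where
  "ring_automorphisms =
     {\<theta>. bij \<theta> \<and> (\<forall>x y. \<theta> (x + y) = \<theta> x + \<theta> y) \<and> (\<forall>x y. \<theta> (x * y) = \<theta> x * \<theta> y) \<and> \<theta> 1 = 1}"

definition int_funpow :: "('a \<Rightarrow> 'a) \<Rightarrow> int \<Rightarrow> 'a \<Rightarrow> 'a" where
  "int_funpow \<theta> k = (if k \<ge> 0 then \<theta> ^^ nat k else inv_into UNIV \<theta> ^^ nat (- k))"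

text \<open>
  Rows and columns are numbered \<open>0, \<dots>, n - 1\<close>, so the exponent \<open>i - 1\<close> attached to row \<open>i\<close> in
  one-based numbering becomes \<open>i\<close>; differences \<open>i - k\<close> of indices are unaffected by the shift.
\<close>

definition row_twist :: "nat \<Rightarrow> ('a \<Rightarrow> 'a) \<Rightarrow> 'a mat \<Rightarrow> 'a mat" where
  "row_twist n \<theta> A = mat n n (\<lambda>(i, j). int_funpow \<theta> (int i) (A $$ (i, j)))"

text \<open>The inverse of \<open>row_twist n \<theta>\<close> is taken on the \<open>n \<times> n\<close> matrices, where it is a bijection
  (see \<open>bij_betw_row_twist\<close>).\<close>

definition twisted_mult ::
  "nat \<Rightarrow> ('a::{ring, monoid_mult} \<Rightarrow> 'a) \<Rightarrow> 'a mat \<Rightarrow> 'a mat \<Rightarrow> 'a mat" where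
  "twisted_mult n \<theta> A B =
     (let \<phi> = row_twist n \<theta>; \<psi> = inv_into (carrier_mat n n) \<phi> in \<phi> (\<psi> A * \<psi> B))"

lemma bij_betw_row_twist:
  assumes "\<theta> \<in> ring_automorphisms"
  shows "bij_betw (row_twist n \<theta>) (carrier_mat n n) (carrier_mat n n)"
proof -
  have bij: "bij (\<theta> ^^ k)" for k
    using assms by (simp add: ring_automorphisms_def bij_betw_funpow)
  let ?g = "\<lambda>A. mat n n (\<lambda>(i, j). inv_into UNIV (\<theta> ^^ i) (A $$ (i, j)))"
  show ?thesis
    by (rule bij_betw_byWitness[where f' = ?g])
      (auto simp: row_twist_def int_funpow_def bij bij_is_inj surj_f_inv_f bij_is_surj)
qed

lemma row_twist_add:
  assumes "\<theta> \<in> ring_automorphisms" "A \<in> carrier_mat n n" "B \<in> carrier_mat n n"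
  shows "row_twist n \<theta> (A + B) = row_twist n \<theta> A + row_twist n \<theta> B"
proof -
  have "(\<theta> ^^ k) (x + y) = (\<theta> ^^ k) x + (\<theta> ^^ k) y" for k x y
    using assms(1) by (induction k) (auto simp: ring_automorphisms_def)
  then show ?thesis
    using assms(2,3) by (auto simp: row_twist_def int_funpow_def)
qed

end

theory Submission
  imports Defs
begin

text \<open>
  Put \<open>X = \<phi>\<inverse> A\<close> and \<open>Y = \<phi>\<inverse> B\<close>, so that \<open>a\<^sub>i\<^sub>k = \<theta>\<^sup>i x\<^sub>i\<^sub>k\<close> and \<open>b\<^sub>k\<^sub>j = \<theta>\<^sup>k y\<^sub>k\<^sub>j\<close> with rows
  counted from \<open>0\<close>. As \<open>\<theta>\<^sup>i\<close> respects sums and products, the \<open>(i, j)\<close> entry of \<open>\<phi> (X Y)\<close> is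
  the sum over \<open>k\<close> of \<open>\<theta>\<^sup>i x\<^sub>i\<^sub>k \<cdot> \<theta>\<^sup>i y\<^sub>k\<^sub>j\<close>. The first factor is \<open>a\<^sub>i\<^sub>k\<close>, untwisted because \<open>X\<close>
  contributes its \<open>i\<close>-th row, the row in which the result lies. But \<open>y\<^sub>k\<^sub>j\<close> lies in row \<open>k\<close>, so
  rewriting the second factor in terms of \<open>b\<^sub>k\<^sub>j\<close> costs the difference of the two twists:
  \<open>\<theta>\<^sup>i y\<^sub>k\<^sub>j = \<theta>\<^sup>i\<^sup>-\<^sup>k b\<^sub>k\<^sub>j\<close> (lemma \<open>int_funpow_diff_funpow\<close>).
\<close>

text \<open>
  This is the only case of the exponent law for integer powers that the product formula needs.
  When \<open>i < k\<close>, the \<open>k - i\<close> inverses cancel against the outermost \<open>k - i\<close> of the \<open>k\<close>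
  applications of \<open>\<theta>\<close>.
\<close>

lemma int_funpow_diff_funpow:
  assumes "bij \<theta>"
  shows "int_funpow \<theta> (int i - int k) ((\<theta> ^^ k) x) = (\<theta> ^^ i) x"
proof (cases "k \<le> i")
  case True
  then have "(\<theta> ^^ i) x = (\<theta> ^^ (i - k)) ((\<theta> ^^ k) x)"
    by (metis comp_apply funpow_add le_add_diff_inverse2)
  with True show ?thesis
    by (simp add: int_funpow_def nat_diff_distrib)
next
  case False
  have cancel: "(inv_into UNIV \<theta> ^^ m) ((\<theta> ^^ m) y) = y" for m y
    using assms by (induction m arbitrary: y) (simp_all add: funpow_swap1 bij_is_inj)
  from False have "(\<theta> ^^ k) x = (\<theta> ^^ (k - i)) ((\<theta> ^^ i) x)"
    by (metis comp_apply funpow_add le_add_diff_inverse2 nat_le_linear)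
  with False cancel show ?thesis
    by (simp add: int_funpow_def nat_diff_distrib)
qed

lemma ring_automorphism_funpow_mult:
  assumes "\<theta> \<in> ring_automorphisms"
  shows "(\<theta> ^^ m) (x * y) = (\<theta> ^^ m) x * (\<theta> ^^ m) y"
  using assms by (induction m) (auto simp: ring_automorphisms_def)

lemma ring_automorphism_funpow_sum:
  assumes "\<theta> \<in> ring_automorphisms"
  shows "(\<theta> ^^ m) (sum f S) = (\<Sum>x\<in>S. (\<theta> ^^ m) (f x))"
proof -
  have add: "(\<theta> ^^ m) (x + y) = (\<theta> ^^ m) x + (\<theta> ^^ m) y" for x y
    using assms by (induction m) (auto simp: ring_automorphisms_def)
  have zero: "(\<theta> ^^ m) 0 = 0"
    using add[of 0 0] by simp
  show ?thesis
    by (induction S rule: infinite_finite_induct) (simp_all add: add zero)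
qed

lemma row_twist_index:
  assumes "i < n" "j < n"
  shows "row_twist n \<theta> A $$ (i, j) = (\<theta> ^^ i) (A $$ (i, j))"
  using assms by (simp add: row_twist_def int_funpow_def)

theorem theorem2p3:
  fixes \<theta> :: "'a::{ring, monoid_mult} \<Rightarrow> 'a" and n :: nat
  assumes "n \<ge> 1"
    and "\<theta> \<in> ring_automorphisms"
  shows "\<forall>A \<in> carrier_mat n n. \<forall>B \<in> carrier_mat n n. \<forall>i < n. \<forall>j < n.
    twisted_mult n \<theta> A B $$ (i, j) =
      (\<Sum>k<n. A $$ (i, k) * int_funpow \<theta> (int i - int k) (B $$ (k, j)))"
proof (intro ballI allI impI)
  fix A B :: "'a mat" and i j
  assume A: "A \<in> carrier_mat n n" and B: "B \<in> carrier_mat n n" and i: "i < n" and j: "j < n"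
  let ?\<psi> = "inv_into (carrier_mat n n) (row_twist n \<theta>)"
  define X Y where "X = ?\<psi> A" and "Y = ?\<psi> B"
  have twist_image: "row_twist n \<theta> ` carrier_mat n n = carrier_mat n n"
    using bij_betw_row_twist[OF assms(2)] by (rule bij_betw_imp_surj_on)
  have X: "X \<in> carrier_mat n n" and Y: "Y \<in> carrier_mat n n"
    using A B twist_image unfolding X_def Y_def by (auto intro: inv_into_into)
  have "row_twist n \<theta> X = A" "row_twist n \<theta> Y = B"
    using A B twist_image unfolding X_def Y_def by (auto intro: f_inv_into_f)
  then have A_entry: "A $$ (i, k) = (\<theta> ^^ i) (X $$ (i, k))"
    and B_entry: "B $$ (k, j) = (\<theta> ^^ k) (Y $$ (k, j))" if "k < n" for k
    using that i j by (auto simp: row_twist_index[symmetric])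
  have bij: "bij \<theta>"
    using assms(2) by (simp add: ring_automorphisms_def)
  have "twisted_mult n \<theta> A B $$ (i, j) = (\<theta> ^^ i) ((X * Y) $$ (i, j))"
    using i j by (simp add: twisted_mult_def Let_def X_def Y_def row_twist_index)
  also have "(X * Y) $$ (i, j) = (\<Sum>k<n. X $$ (i, k) * Y $$ (k, j))"
    using X Y i j by (simp add: scalar_prod_def lessThan_atLeast0)
  also have "(\<theta> ^^ i) \<dots> = (\<Sum>k<n. (\<theta> ^^ i) (X $$ (i, k)) * (\<theta> ^^ i) (Y $$ (k, j)))"
    using assms(2) by (simp add: ring_automorphism_funpow_sum ring_automorphism_funpow_mult)
  also have "\<dots> = (\<Sum>k<n. A $$ (i, k) * int_funpow \<theta> (int i - int k) (B $$ (k, j)))"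
    by (rule sum.cong) (simp_all add: A_entry B_entry int_funpow_diff_funpow[OF bij])
  finally show "twisted_mult n \<theta> A B $$ (i, j) =
      (\<Sum>k<n. A $$ (i, k) * int_funpow \<theta> (int i - int k) (B $$ (k, j)))" .
qed

end
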